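(* Let $(X,X_+)$ be a pre-Riesz space with $n = \dim X < \infty$. If there exist at least $n$ distinct band projections of rank $1$ on $X$, then $X$ is an Archimedean vector lattice, i.e., $X$ is linearly order isomorphic to $\mathbb{R}^n$ with the standard cone $[0,\infty)^n$.
   Context: An ordered vector space $(X,X_+)$ is a real vector space $X$ with a non-empty set $X_+ \subseteq X$ such that $X_+ \cap (-X_+) = \{0\}$ and $\alpha X_+ + \beta X_+ \subseteq X_+$ for all $\alpha,\beta \in [0,\infty)$; one writes $x \le y$ if $y - x \in X_+$. It is Archimedean if, for all $x,y \in X$, $nx \le y$ for all $n \in \{1,2,\dots\}$ implies $x \le 0$. It is a pre-Riesz space if for every non-empty finite set $A \subseteq X$ and every $x \in X$: if every upper bound of $x + A$ is an upper bound of $A$, then $x \in X_+$. A linear order isomorphism between ordered vector spaces is a linear bijection that maps the positive cone of the first space onto the positive cone of the second. Two elements $x,y \in X$ are disjoint, $x \perp y$, if the sets $\{x+y,-x-y\}$ and $\{x-y,y-x\}$ have the same set of upper bounds in $X$. For $S \subseteq X$, $S^\perp := \{x \in X : x \perp s \text{ for all } s \in S\}$ (in a pre-Riesz space this is always a vector subspace). A set $B \subseteq X$ is a band if $B = B^{\perp\perp} := (B^\perp)^\perp$. A band $B$ is a projection band if $X = B \oplus B^\perp$. A linear projection $P: X \to X$ is a band projection if there is a projection band $B$ such that $P$ is the projection onto $B$ along $B^\perp$. *)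

theory Defs
  imports Complex_Main "Jordan_Normal_Form.Matrix"
begin

text \<open>An ordered vector space is a type of class \<^class>\<open>real_vector\<close> (the whole type is \<open>X\<close>)
  together with an explicit positive cone \<open>C\<close>; the order is written \<open>cone_le C\<close>, so that no
  order class instance on the type is involved.\<close>

definition ordered_vector_space :: "'a::real_vector set \<Rightarrow> bool" where
  "ordered_vector_space C \<longleftrightarrow>
     C \<noteq> {} \<and> C \<inter> uminus ` C = {0} \<and>
     (\<forall>\<alpha>\<ge>0. \<forall>\<beta>\<ge>0. \<forall>x\<in>C. \<forall>y\<in>C. \<alpha> *\<^sub>R x + \<beta> *\<^sub>R y \<in> C)"

definition cone_le :: "'a::real_vector set \<Rightarrow> 'a \<Rightarrow> 'a \<Rightarrow> bool" where
  "cone_le C x y \<longleftrightarrow> y - x \<in> C"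

definition upper_bounds :: "'a::real_vector set \<Rightarrow> 'a set \<Rightarrow> 'a set" where
  "upper_bounds C A = {u. \<forall>a\<in>A. cone_le C a u}"

definition archimedean_ovs :: "'a::real_vector set \<Rightarrow> bool" where
  "archimedean_ovs C \<longleftrightarrow> ordered_vector_space C \<and>
     (\<forall>x y. (\<forall>n::nat. 1 \<le> n \<longrightarrow> cone_le C (real n *\<^sub>R x) y) \<longrightarrow> cone_le C x 0)"

definition vector_lattice :: "'a::real_vector set \<Rightarrow> bool" where
  "vector_lattice C \<longleftrightarrow> ordered_vector_space C \<and>
     (\<forall>x y. \<exists>s\<in>upper_bounds C {x, y}. \<forall>u\<in>upper_bounds C {x, y}. cone_le C s u)"

definition pre_riesz_space :: "'a::real_vector set \<Rightarrow> bool" where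
  "pre_riesz_space C \<longleftrightarrow> ordered_vector_space C \<and>
     (\<forall>A x. finite A \<longrightarrow> A \<noteq> {} \<longrightarrow>
        upper_bounds C ((\<lambda>a. x + a) ` A) \<subseteq> upper_bounds C A \<longrightarrow> x \<in> C)"

definition disjoint_elems :: "'a::real_vector set \<Rightarrow> 'a \<Rightarrow> 'a \<Rightarrow> bool" where
  "disjoint_elems C x y \<longleftrightarrow>
     upper_bounds C {x + y, - x - y} = upper_bounds C {x - y, y - x}"

definition disjoint_compl :: "'a::real_vector set \<Rightarrow> 'a set \<Rightarrow> 'a set" where
  "disjoint_compl C S = {x. \<forall>s\<in>S. disjoint_elems C x s}"

definition is_band :: "'a::real_vector set \<Rightarrow> 'a set \<Rightarrow> bool" where
  "is_band C B \<longleftrightarrow> B = disjoint_compl C (disjoint_compl C B)"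

definition direct_sum_decomp :: "'a::real_vector set \<Rightarrow> 'a set \<Rightarrow> bool" where
  "direct_sum_decomp U V \<longleftrightarrow> subspace U \<and> subspace V \<and> U \<inter> V = {0} \<and>
     (\<forall>x. \<exists>u\<in>U. \<exists>v\<in>V. x = u + v)"

definition projection_band :: "'a::real_vector set \<Rightarrow> 'a set \<Rightarrow> bool" where
  "projection_band C B \<longleftrightarrow> is_band C B \<and> direct_sum_decomp B (disjoint_compl C B)"

definition band_projection :: "'a::real_vector set \<Rightarrow> ('a \<Rightarrow> 'a) \<Rightarrow> bool" where
  "band_projection C P \<longleftrightarrow> linear P \<and>
     (\<exists>B. projection_band C B \<and> (\<forall>b\<in>B. P b = b) \<and> (\<forall>d\<in>disjoint_compl C B. P d = 0))"

definition map_rank :: "('a::real_vector \<Rightarrow> 'b::real_vector) \<Rightarrow> nat" where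
  "map_rank f = dim (range f)"

text \<open>The space \<open>\<real>\<^sup>n\<close> is rendered as \<^term>\<open>carrier_vec n :: real vec set\<close>, which, unlike
  a space indexed by a finite type, also covers \<open>n = 0\<close>.\<close>

definition standard_cone :: "nat \<Rightarrow> real vec set" where
  "standard_cone n = {v \<in> carrier_vec n. \<forall>i<n. 0 \<le> v $ i}"

definition linear_order_iso_vec ::
    "'a::real_vector set \<Rightarrow> nat \<Rightarrow> real vec set \<Rightarrow> ('a \<Rightarrow> real vec) \<Rightarrow> bool" where
  "linear_order_iso_vec C n D f \<longleftrightarrow>
     bij_betw f UNIV (carrier_vec n) \<and>
     (\<forall>x y. f (x + y) = f x + f y) \<and>
     (\<forall>c x. f (c *\<^sub>R x) = c \<cdot>\<^sub>v f x) \<and>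
     f ` C = D"

end

theory Submission
  imports Defs
begin

text \<open>A pre-Riesz space is directed. If \<open>u \<perp> v\<close> and \<open>u + v \<ge> 0\<close>, then \<open>u + v\<close> is an upper
  bound of \<open>{u + v, - u - v}\<close>, hence of \<open>{u - v, v - u}\<close>, so \<open>u \<ge> 0\<close> and \<open>v \<ge> 0\<close>: a band
  projection \<open>P\<close> satisfies \<open>0 \<le> P x \<le> x\<close> for \<open>x \<ge> 0\<close>. By directedness a band projection of
  rank one maps onto the line through some positive \<open>b \<noteq> 0\<close>. If \<open>Q\<close> is another one, with
  positive vector \<open>c\<close>, then \<open>P c = t b\<close> with \<open>0 \<le> t b \<le> c\<close>; for \<open>t > 0\<close> applying \<open>I - Q\<close>
  gives \<open>Q b = b\<close>, so both projections have the same range and coincide. Hence \<open>P c = 0\<close>, the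
  \<open>n\<close> positive vectors form a basis, and the cone consists of the vectors with nonnegative
  coordinates.\<close>

section \<open>Cone arithmetic and directedness\<close>

lemma cone_zero: "ordered_vector_space C \<Longrightarrow> 0 \<in> C"
  unfolding ordered_vector_space_def by blast

lemma cone_add:
  assumes "ordered_vector_space C" "x \<in> C" "y \<in> C"
  shows "x + y \<in> C"
proof -
  have "1 *\<^sub>R x + 1 *\<^sub>R y \<in> C"
    using assms unfolding ordered_vector_space_def by (meson zero_le_one)
  then show ?thesis by simp
qed

lemma cone_scaleR:
  assumes "ordered_vector_space C" "x \<in> C" "0 \<le> a"
  shows "a *\<^sub>R x \<in> C"
proof -
  have "a *\<^sub>R x + 0 *\<^sub>R x \<in> C"
    using assms unfolding ordered_vector_space_def by (meson order_refl)
  then show ?thesis by simp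
qed

lemma cone_sum:
  assumes "ordered_vector_space C" "\<And>i. i \<in> I \<Longrightarrow> f i \<in> C"
  shows "sum f I \<in> C"
  using assms(2)
  by (induction I rule: infinite_finite_induct) (auto intro: cone_zero cone_add assms(1))

lemma cone_antisym:
  assumes "ordered_vector_space C" "x \<in> C" "- x \<in> C"
  shows "x = 0"
proof -
  have "x \<in> C \<inter> uminus ` C"
    using assms(2,3) by (metis IntI imageI minus_minus)
  then show ?thesis
    using assms(1) unfolding ordered_vector_space_def by auto
qed

text \<open>If \<open>{0, x}\<close> had no upper bound, neither would any translate of it. The
  pre-Riesz condition would then hold vacuously for every vector and force \<open>C\<close> to be
  the whole space, where 0 is already an upper bound.\<close>

lemma pre_riesz_directed:
  assumes "pre_riesz_space C"
  shows "\<exists>u\<in>C. u - x \<in> C"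
proof (rule ccontr)
  assume none: "\<not> ?thesis"
  have "upper_bounds C ((\<lambda>a. y + a) ` {0, x}) \<subseteq> upper_bounds C {0, x}" for y
  proof
    \<comment> \<open>An upper bound \<open>u\<close> of the translate by \<open>y\<close> makes
      \<open>u - y\<close> an upper bound of \<open>{0, x}\<close>, which \<open>none\<close>
      excludes.\<close>
    fix u assume "u \<in> upper_bounds C ((\<lambda>a. y + a) ` {0, x})"
    then have "u - y \<in> C" "u - y - x \<in> C"
      by (auto simp: upper_bounds_def cone_le_def algebra_simps)
    then show "u \<in> upper_bounds C {0, x}"
      using none by blast
  qed
  then have all: "y \<in> C" for y
    using assms[unfolded pre_riesz_space_def, THEN conjunct2, rule_format, of "{0, x}" y] by blast
  show False
    using none all[of 0] all[of "0 - x"] by blast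
qed

section \<open>Disjointness and positivity of band projections\<close>

lemma disjoint_sum_positive:
  assumes ov: "ordered_vector_space C" and "disjoint_elems C u v" "u + v \<in> C"
  shows "u \<in> C" "v \<in> C"
proof -
  have "(u + v) - (- u - v) = 2 *\<^sub>R (u + v)"
    by (simp add: scaleR_2)
  then have "u + v \<in> upper_bounds C {u + v, - u - v}"
    using cone_zero[OF ov] cone_scaleR[OF ov assms(3), of 2]
    by (auto simp: upper_bounds_def cone_le_def)
  then have "u + v \<in> upper_bounds C {u - v, v - u}"
    using assms(2) by (simp add: disjoint_elems_def)
  then have "(u + v) - (v - u) \<in> C" "(u + v) - (u - v) \<in> C"
    by (auto simp: upper_bounds_def cone_le_def)
  then have "2 *\<^sub>R u \<in> C" "2 *\<^sub>R v \<in> C"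
    by (simp_all add: scaleR_2)
  then have "(1/2) *\<^sub>R 2 *\<^sub>R u \<in> C" "(1/2) *\<^sub>R 2 *\<^sub>R v \<in> C"
    using cone_scaleR[OF ov] by (metis zero_le_divide_1_iff zero_le_numeral)+
  then show "u \<in> C" "v \<in> C"
    by simp_all
qed

lemma disjoint_elems_commute: "disjoint_elems C x y \<longleftrightarrow> disjoint_elems C y x"
proof -
  have "{x + y, - x - y} = {y + x, - y - x}" "{x - y, y - x} = {y - x, x - y}"
    by auto
  then show ?thesis
    unfolding disjoint_elems_def by simp
qed

lemma band_projection_positive:
  assumes ov: "ordered_vector_space C" and "band_projection C P" "x \<in> C"
  shows "P x \<in> C" "x - P x \<in> C"
proof -
  obtain B where lin: "linear P" and B: "projection_band C B"
    and P: "\<forall>b\<in>B. P b = b" "\<forall>d\<in>disjoint_compl C B. P d = 0"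
    using assms(2) unfolding band_projection_def by blast
  obtain u v where uv: "u \<in> B" "v \<in> disjoint_compl C B" "x = u + v"
    using B unfolding projection_band_def direct_sum_decomp_def by blast
  have "disjoint_elems C u v"
    using uv by (auto simp: disjoint_compl_def disjoint_elems_commute)
  then have "u \<in> C" "v \<in> C"
    using disjoint_sum_positive[OF ov] assms(3) uv(3) by auto
  moreover have "P x = u"
    using uv P by (simp add: linear_add[OF lin])
  ultimately show "P x \<in> C" "x - P x \<in> C"
    using uv(3) by auto
qed

text \<open>The band hidden in the existential quantifier can only be the range of \<open>P\<close>,
  since \<open>P\<close> fixes \<open>B\<close> and kills the complementary summand. From here on
  \<open>range P\<close> replaces it.\<close>

lemma band_projection_range:
  assumes "band_projection C P"
  shows "(\<forall>b\<in>range P. P b = b) \<and> (\<forall>d\<in>disjoint_compl C (range P). P d = 0) \<and>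
    projection_band C (range P)"
proof -
  obtain B where lin: "linear P" and B: "projection_band C B"
    and P: "\<forall>b\<in>B. P b = b" "\<forall>d\<in>disjoint_compl C B. P d = 0"
    using assms unfolding band_projection_def by blast
  have "P x \<in> B" for x
  proof -
    obtain u v where "u \<in> B" "v \<in> disjoint_compl C B" "x = u + v"
      using B unfolding projection_band_def direct_sum_decomp_def by blast
    then show ?thesis
      using P by (simp add: linear_add[OF lin])
  qed
  moreover have "b \<in> range P" if "b \<in> B" for b
    using P(1) that by (metis rangeI)
  ultimately have "range P = B"
    by blast
  then show ?thesis
    using B P by simp
qed

text \<open>The range determines its disjoint complement, so it fixes both summands of the
  decomposition, and with them the projection.\<close>

lemma band_projection_eqI:
  assumes "band_projection C P" "band_projection C Q" "range P = range Q"
  shows "P = Q"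
proof
  fix x
  have lin: "linear P" "linear Q"
    using assms(1,2) by (auto simp: band_projection_def)
  note P = band_projection_range[OF assms(1)] and Q = band_projection_range[OF assms(2)]
  obtain u v where uv: "u \<in> range P" "v \<in> disjoint_compl C (range P)" and x: "x = u + v"
    using P unfolding projection_band_def direct_sum_decomp_def by blast
  have "P u = u" "P v = 0" "Q u = u" "Q v = 0"
    using P Q uv unfolding assms(3) by blast+
  then show "P x = Q x"
    by (simp add: x linear_add[OF lin(1)] linear_add[OF lin(2)])
qed

section \<open>Band projections of rank one\<close>

lemma rank_one_band_projection:
  assumes "pre_riesz_space C" "band_projection C P" "map_rank P = 1"
  obtains b where "b \<in> C" "b \<noteq> 0" "range P = span {b}"
proof -
  have ov: "ordered_vector_space C"
    using assms(1) by (simp add: pre_riesz_space_def)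
  have lin: "linear P"
    using assms(2) by (simp add: band_projection_def)
  obtain S where S: "S \<subseteq> range P" "independent S" "range P \<subseteq> span S" "card S = 1"
    using basis_exists[of "range P"] assms(3) unfolding map_rank_def by metis
  obtain a where a: "S = {a}"
    using S(4) by (auto simp: card_1_singleton_iff)
  have a0: "a \<noteq> 0"
    using S(2) a dependent_zero by auto
  have Pa: "P a = a"
    using band_projection_range[OF assms(2)] S(1) a by blast
  \<comment> \<open>The spanning vector \<open>a\<close> need not be positive, but it is the
    difference of the positive vectors \<open>u\<close> and \<open>u - a\<close>. As
    \<open>P a = a\<close> is nonzero, \<open>P\<close> cannot kill both, and the image of a
    surviving one is a positive vector spanning the line.\<close>
  obtain u where u: "u \<in> C" "u - a \<in> C"
    using pre_riesz_directed[OF assms(1)] by blast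
  have "P u - P (u - a) = a"
    using Pa by (simp add: linear_diff[OF lin])
  then have "P u \<noteq> 0 \<or> P (u - a) \<noteq> 0"
    using a0 by auto
  then obtain w where w: "w \<in> C" "P w \<noteq> 0"
    using u by blast
  obtain k where k: "P w = k *\<^sub>R a"
    using S(3) a by (auto simp: span_singleton)
  then have "k \<noteq> 0"
    using w(2) by auto
  have "range P = span {P w}"
  proof
    show "span {P w} \<subseteq> range P"
      by (rule span_minimal) (auto intro: linear_subspace_image[OF lin])
    show "range P \<subseteq> span {P w}"
    proof
      fix y assume "y \<in> range P"
      then obtain l where "y = l *\<^sub>R a"
        using S(3) a by (auto simp: span_singleton)
      then have "y = (l / k) *\<^sub>R P w"
        using k \<open>k \<noteq> 0\<close> by simp
      then show "y \<in> span {P w}"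
        by (simp add: span_base span_scale)
    qed
  qed
  then show ?thesis
    using that band_projection_positive(1)[OF ov assms(2) w(1)] w(2) by blast
qed

lemma rank_one_band_projections_orthogonal:
  assumes ov: "ordered_vector_space C"
    and P: "band_projection C P" "range P = span {b}" "b \<in> C" "b \<noteq> 0"
    and Q: "band_projection C Q" "range Q = span {c}" "c \<in> C"
    and "P \<noteq> Q"
  shows "P c = 0"
proof (rule ccontr)
  assume nz: "P c \<noteq> 0"
  obtain t where t: "P c = t *\<^sub>R b"
    using P(2) rangeI[of P c] by (auto simp: span_singleton)
  have lin: "linear Q"
    using Q(1) by (simp add: band_projection_def)
  have Qc: "Q c = c"
    using band_projection_range[OF Q(1)] Q(2) by (simp add: span_base)
  have pos: "P c \<in> C" "c - P c \<in> C"
    using band_projection_positive[OF ov P(1) Q(3)] .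
  \<comment> \<open>The map \<open>I - Q\<close> preserves \<open>C\<close> and kills
    \<open>c\<close>. Applied to \<open>P c\<close> and to \<open>c - P c\<close> it yields opposite
    vectors of \<open>C\<close>, hence zero.\<close>
  have "P c - Q (P c) \<in> C" "(c - P c) - Q (c - P c) \<in> C"
    using band_projection_positive(2)[OF ov Q(1)] pos by auto
  moreover have "(c - P c) - Q (c - P c) = - (P c - Q (P c))"
    using Qc by (simp add: linear_diff[OF lin])
  ultimately have "P c = Q (P c)"
    using cone_antisym[OF ov] by (metis eq_iff_diff_eq_0)
  then have "P c \<in> range Q"
    by (metis rangeI)
  then obtain s where s: "P c = s *\<^sub>R c"
    using Q(2) by (auto simp: span_singleton)
  have "s \<noteq> 0" "t \<noteq> 0"
    using s t nz by auto
  \<comment> \<open>\<open>P c\<close> is a nonzero multiple of both \<open>b\<close> and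
    \<open>c\<close>, so the two lines agree.\<close>
  have "span {b} = span {P c}" "span {c} = span {P c}"
    using s t \<open>s \<noteq> 0\<close> \<open>t \<noteq> 0\<close> span_image_scale[of "{b}" "\<lambda>_. t"] span_image_scale[of "{c}" "\<lambda>_. s"]
    by simp_all
  then have "range P = range Q"
    using P(2) Q(2) by simp
  then show False
    using band_projection_eqI[OF P(1) Q(1)] assms(9) by simp
qed

section \<open>Coordinates and the standard cone\<close>

lemma independent_card_dim_span:
  fixes S :: "'a::real_vector set"
  assumes "finite B" "span B = (UNIV :: 'a set)" "independent S" "finite S"
    and "dim (UNIV :: 'a set) \<le> card S"
  shows "span S = UNIV"
proof (rule ccontr)
  assume "span S \<noteq> UNIV"
  then obtain x where x: "x \<notin> span S"
    by blast
  then have "independent (insert x S)" "x \<notin> S"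
    using assms(3) by (auto simp: independent_insert intro: span_base)
  \<comment> \<open>The set \<open>insert x S\<close> would be an independent set larger than a
    basis \<open>D\<close>. The finite spanning set \<open>B\<close> ensures that \<open>D\<close>
    is finite, so that cardinalities can be compared.\<close>
  obtain D :: "'a set" where D: "independent D" "UNIV \<subseteq> span D" "card D = dim (UNIV :: 'a set)"
    using basis_exists[of "UNIV :: 'a set"] by metis
  have "finite D"
    using independent_span_bound[OF assms(1) D(1)] assms(2) by auto
  then have "card (insert x S) \<le> card D"
    using independent_span_bound[OF _ \<open>independent (insert x S)\<close>, of D] D(2) by blast
  then show False
    using \<open>x \<notin> S\<close> assms(4,5) D(3) by simp
qed

lemma biorthogonal_coordinate:
  fixes \<phi> :: "nat \<Rightarrow> 'a::real_vector \<Rightarrow> real" and b :: "nat \<Rightarrow> 'a"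
  assumes "linear (\<phi> i)" "\<And>j. j < n \<Longrightarrow> \<phi> i (b j) = (if i = j then 1 else 0)" "i < n"
  shows "\<phi> i (\<Sum>j<n. a j *\<^sub>R b j) = a i"
proof -
  have "\<phi> i (\<Sum>j<n. a j *\<^sub>R b j) = (\<Sum>j<n. a j * \<phi> i (b j))"
    using assms(1) by (simp add: linear_sum linear_scale)
  also have "\<dots> = (\<Sum>j<n. if i = j then a j else 0)"
    using assms(2) by (intro sum.cong) auto
  finally show ?thesis
    using assms(3) by simp
qed

text \<open>By linearity, \<open>cone\<close> turns the order into the coordinatewise order
  (\<open>le\<close>), so each claim reduces to a fact about real numbers in every
  coordinate.\<close>

lemma coordinate_cone_is_standard:
  fixes C :: "'a::real_vector set" and \<phi> :: "nat \<Rightarrow> 'a \<Rightarrow> real" and b :: "nat \<Rightarrow> 'a"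
  assumes ov: "ordered_vector_space C"
    and lin: "\<And>i. i < n \<Longrightarrow> linear (\<phi> i)"
    and expand: "\<And>x. (\<Sum>i<n. \<phi> i x *\<^sub>R b i) = x"
    and dual: "\<And>i j. i < n \<Longrightarrow> j < n \<Longrightarrow> \<phi> i (b j) = (if i = j then 1 else 0)"
    and cone: "\<And>x. x \<in> C \<longleftrightarrow> (\<forall>i<n. 0 \<le> \<phi> i x)"
  shows "archimedean_ovs C" "vector_lattice C"
    "\<exists>f. linear_order_iso_vec C n (standard_cone n) f"
proof -
  have coord: "\<phi> i (\<Sum>j<n. a j *\<^sub>R b j) = a i" if "i < n" for i a
    using biorthogonal_coordinate lin dual that by blast
  have le: "cone_le C x y \<longleftrightarrow> (\<forall>i<n. \<phi> i x \<le> \<phi> i y)" for x y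
    unfolding cone_le_def cone using lin by (auto simp: linear_diff)
  show "archimedean_ovs C"
    unfolding archimedean_ovs_def
  proof (intro conjI allI impI)
    fix x y assume bound: "\<forall>m::nat. 1 \<le> m \<longrightarrow> cone_le C (real m *\<^sub>R x) y"
    have "\<phi> i x \<le> \<phi> i 0" if "i < n" for i
    proof (rule ccontr)
      assume "\<not> \<phi> i x \<le> \<phi> i 0"
      then have "0 < \<phi> i x"
        using linear_0[OF lin[OF that]] by simp
      then obtain m where m: "\<phi> i y < real m * \<phi> i x"
        using reals_Archimedean3 by blast
      \<comment> \<open>The Archimedean property of the reals may return \<open>m = 0\<close>,
        whereas \<open>bound\<close> starts at 1; hence the passage to \<open>Suc m\<close>.\<close>
      have "\<phi> i y < real (Suc m) * \<phi> i x"
        using m \<open>0 < \<phi> i x\<close> by (simp add: distrib_right)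
      moreover have "real (Suc m) * \<phi> i x \<le> \<phi> i y"
        using bound[rule_format, of "Suc m"] that lin[OF that] by (auto simp: le linear_scale)
      ultimately show False
        by simp
    qed
    then show "cone_le C x 0"
      by (simp add: le)
  qed (rule ov)
  show "vector_lattice C"
    unfolding vector_lattice_def
  proof (intro conjI allI)
    fix x y
    \<comment> \<open>The supremum is taken coordinate by coordinate.\<close>
    define s where "s = (\<Sum>i<n. max (\<phi> i x) (\<phi> i y) *\<^sub>R b i)"
    have "\<phi> i s = max (\<phi> i x) (\<phi> i y)" if "i < n" for i
      unfolding s_def using coord[OF that] .
    then show "\<exists>s\<in>upper_bounds C {x, y}. \<forall>u\<in>upper_bounds C {x, y}. cone_le C s u"
      by (intro bexI[of _ s]) (auto simp: upper_bounds_def le)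
  qed (rule ov)
  define f where "f x = vec n (\<lambda>i. \<phi> i x)" for x
  have inv: "f (\<Sum>j<n. (v $ j) *\<^sub>R b j) = v" if "v \<in> carrier_vec n" for v
    using that by (intro eq_vecI) (auto simp: f_def coord)
  have "bij_betw f UNIV (carrier_vec n)"
  proof (rule bij_betwI[where g = "\<lambda>v. \<Sum>j<n. (v $ j) *\<^sub>R b j"])
    show "(\<Sum>j<n. (f x $ j) *\<^sub>R b j) = x" for x
      using expand[of x] by (simp add: f_def)
  qed (auto simp: f_def[abs_def] inv[unfolded f_def])
  moreover have "f (x + y) = f x + f y" for x y
    using lin by (intro eq_vecI) (auto simp: f_def linear_add)
  moreover have "f (a *\<^sub>R x) = a \<cdot>\<^sub>v f x" for a x
    using lin by (intro eq_vecI) (auto simp: f_def linear_scale)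
  moreover have "f ` C = standard_cone n"
  proof
    show "f ` C \<subseteq> standard_cone n"
      by (auto simp: f_def standard_cone_def cone)
    show "standard_cone n \<subseteq> f ` C"
    proof
      fix v assume v: "v \<in> standard_cone n"
      then have "(\<Sum>j<n. (v $ j) *\<^sub>R b j) \<in> C"
        by (simp add: cone coord standard_cone_def)
      then show "v \<in> f ` C"
        using inv[of v] v by (force simp: standard_cone_def)
    qed
  qed
  ultimately have "linear_order_iso_vec C n (standard_cone n) f"
    unfolding linear_order_iso_vec_def by blast
  then show "\<exists>f. linear_order_iso_vec C n (standard_cone n) f"
    by blast
qed

section \<open>The positive basis and its dual functionals\<close>

theorem theorem4p2:
  fixes C :: "'a::real_vector set" and n :: nat
  assumes "pre_riesz_space C"
    and "\<exists>B::'a set. finite B \<and> span B = UNIV"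
    and "n = dim (UNIV :: 'a set)"
    and "\<exists>\<P>. finite \<P> \<and> n \<le> card \<P> \<and> (\<forall>P\<in>\<P>. band_projection C P \<and> map_rank P = 1)"
  shows "archimedean_ovs C \<and> vector_lattice C \<and>
    (\<exists>f. linear_order_iso_vec C n (standard_cone n) f)"
proof -
  have ov: "ordered_vector_space C"
    using assms(1) by (simp add: pre_riesz_space_def)
  \<comment> \<open>Exactly \<open>n\<close> projections are kept, so that their positive vectors
    can be counted against the dimension.\<close>
  obtain \<P> where \<P>: "card \<P> = n" "finite \<P>"
    and proj: "\<And>P. P \<in> \<P> \<Longrightarrow> band_projection C P \<and> map_rank P = 1"
    using assms(4) by (metis obtain_subset_with_card_n subsetD)
  obtain p where p: "bij_betw p {..<n} \<P>"
    using ex_bij_betw_nat_finite[OF \<P>(2)] \<P>(1) by (auto simp: lessThan_atLeast0)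
  have bp: "band_projection C (p i)" and rk: "map_rank (p i) = 1" if "i < n" for i
    using proj[of "p i"] bij_betwE[OF p] that by auto
  have linp: "linear (p i)" if "i < n" for i
    using bp[OF that] by (simp add: band_projection_def)
  have "\<forall>i. \<exists>b. i < n \<longrightarrow> b \<in> C \<and> b \<noteq> 0 \<and> range (p i) = span {b}"
    using rank_one_band_projection[OF assms(1) bp rk] by metis
  then obtain b where b: "\<And>i. i < n \<Longrightarrow> b i \<in> C" "\<And>i. i < n \<Longrightarrow> b i \<noteq> 0"
    "\<And>i. i < n \<Longrightarrow> range (p i) = span {b i}"
    by metis
  have "\<exists>t. p i x = t *\<^sub>R b i" if "i < n" for i x
    using b(3)[OF that] rangeI[of "p i" x] by (auto simp: span_singleton)
  \<comment> \<open>\<open>\<phi> i\<close> is the coefficient of \<open>p i\<close> along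
    \<open>b i\<close>; it is unique because \<open>b i\<close> is nonzero, and so inherits
    linearity from \<open>p i\<close>.\<close>
  then obtain \<phi> where \<phi>: "\<And>i x. i < n \<Longrightarrow> p i x = \<phi> i x *\<^sub>R b i"
    by metis
  have lin: "linear (\<phi> i)" if "i < n" for i
  proof (rule linearI)
    fix x y
    have "\<phi> i (x + y) *\<^sub>R b i = (\<phi> i x + \<phi> i y) *\<^sub>R b i"
      using that by (simp add: \<phi>[symmetric] linear_add[OF linp] scaleR_add_left)
    then show "\<phi> i (x + y) = \<phi> i x + \<phi> i y"
      using b(2)[OF that] by simp
  next
    fix r x
    have "\<phi> i (r *\<^sub>R x) *\<^sub>R b i = (r * \<phi> i x) *\<^sub>R b i"
      using that by (simp add: \<phi>[symmetric] linear_scale[OF linp] flip: scaleR_scaleR)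
    then show "\<phi> i (r *\<^sub>R x) = r *\<^sub>R \<phi> i x"
      using b(2)[OF that] by simp
  qed
  have dual: "\<phi> i (b j) = (if i = j then 1 else 0)" if ij: "i < n" "j < n" for i j
  proof (cases "i = j")
    case True
    have "p i (b i) = b i"
      using band_projection_range[OF bp[OF ij(1)]] b(3)[OF ij(1)] by (simp add: span_base)
    then show ?thesis
      using True \<phi>[OF ij(1), of "b i"] b(2)[OF ij(1)] scaleR_right_imp_eq[of "b i" "\<phi> i (b i)" 1]
      by simp
  next
    case False
    then have "p i \<noteq> p j"
      using p ij by (auto simp: bij_betw_def inj_on_def)
    then have "p i (b j) = 0"
      using rank_one_band_projections_orthogonal[OF ov bp[OF ij(1)] b(3)[OF ij(1)] b(1)[OF ij(1)]
          b(2)[OF ij(1)] bp[OF ij(2)] b(3)[OF ij(2)] b(1)[OF ij(2)]] by simp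
    then show ?thesis
      using False \<phi>[OF ij(1), of "b j"] b(2)[OF ij(1)] by simp
  qed
  have inj: "inj_on b {..<n}"
    by (rule inj_onI) (metis dual lessThan_iff zero_neq_one)
  have coord: "\<phi> i (\<Sum>j<n. a j *\<^sub>R b j) = a i" if "i < n" for i a
    using biorthogonal_coordinate lin dual that by blast
  \<comment> \<open>Applying \<open>\<phi> i\<close> to a vanishing combination isolates its
    coefficient at \<open>b i\<close>.\<close>
  have "independent (b ` {..<n})"
  proof (rule independent_if_scalars_zero)
    fix g v assume "(\<Sum>x\<in>b ` {..<n}. g x *\<^sub>R x) = 0" and "v \<in> b ` {..<n}"
    then obtain i where i: "i < n" "v = b i" and "(\<Sum>j<n. g (b j) *\<^sub>R b j) = 0"
      using inj by (auto simp: sum.reindex)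
    then show "g v = 0"
      using coord[OF i(1), of "\<lambda>j. g (b j)"] linear_0[OF lin[OF i(1)]] by simp
  qed simp
  then have spanb: "span (b ` {..<n}) = UNIV"
    using independent_card_dim_span assms(2,3) card_image[OF inj] by (metis card_lessThan
        finite_imageI finite_lessThan order_refl)
  have expand: "(\<Sum>i<n. \<phi> i x *\<^sub>R b i) = x" for x
  proof -
    have "x \<in> span (b ` {..<n})"
      using spanb by simp
    then obtain g where "x = (\<Sum>v\<in>b ` {..<n}. g v *\<^sub>R v)"
      by (auto simp: span_finite)
    then have x: "x = (\<Sum>j<n. g (b j) *\<^sub>R b j)"
      using inj by (simp add: sum.reindex)
    have "\<phi> i x = g (b i)" if "i < n" for i
      unfolding x using coord[OF that] .
    then show ?thesis
      using x by simp
  qed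
  \<comment> \<open>For positive \<open>x\<close>, the vector \<open>p i x\<close> is positive; a
    negative coefficient would put its negative into \<open>C\<close> too, against antisymmetry.
    Conversely, \<open>expand\<close> writes \<open>x\<close> as a nonnegative combination of
    vectors of \<open>C\<close>.\<close>
  have cone: "x \<in> C \<longleftrightarrow> (\<forall>i<n. 0 \<le> \<phi> i x)" for x
  proof
    assume x: "x \<in> C"
    show "\<forall>i<n. 0 \<le> \<phi> i x"
    proof (intro allI impI, rule ccontr)
      fix i assume i: "i < n" and "\<not> 0 \<le> \<phi> i x"
      then have "- (\<phi> i x *\<^sub>R b i) \<in> C"
        using cone_scaleR[OF ov b(1)[OF i], of "- \<phi> i x"] by simp
      moreover have "\<phi> i x *\<^sub>R b i \<in> C"
        using band_projection_positive(1)[OF ov bp[OF i] x] \<phi>[OF i] by simp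
      ultimately have "\<phi> i x *\<^sub>R b i = 0"
        using cone_antisym[OF ov] by blast
      then show False
        using b(2)[OF i] \<open>\<not> 0 \<le> \<phi> i x\<close> by simp
    qed
  next
    assume "\<forall>i<n. 0 \<le> \<phi> i x"
    then have "(\<Sum>i<n. \<phi> i x *\<^sub>R b i) \<in> C"
      using b(1) by (intro cone_sum[OF ov]) (auto intro: cone_scaleR[OF ov])
    then show "x \<in> C"
      by (simp add: expand)
  qed
  show ?thesis
    using coordinate_cone_is_standard[OF ov lin expand dual cone] by blast
qed

end
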